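(* Let $(X_i,Y_i)\in\mathbb{R}^p\times\mathbb{R}$, $1\le i\le n$, be random vectors ($p$ may depend on $n$), let $\ell(\cdot,\cdot)$ be a loss function twice differentiable and convex in its first argument, and let $h$ be a non-negative weight function. For $1\le j\le p$ let $$\beta_{n,j}:=\arg\min_{\theta\in\mathbb{R}}\frac1n\sum_{i=1}^n\mathbb{E}[h(X_i(j))\ell(X_i(j)\theta,Y_i)],\qquad\hat\beta_{n,j}:=\arg\min_{\theta\in\mathbb{R}}\frac1n\sum_{i=1}^nh(X_i(j))\ell(X_i(j)\theta,Y_i).$$ If $$\max_{1\le j\le p}\max_{1\le i\le n}C(|X_i(j)|\delta_{n,j},Y_i)\le\frac43,$$ then simultaneously for all $j\in\{1,\dots,p\}$, $$\big|\hat\beta_{n,j}-\beta_{n,j}+[\mathcal{Q}_{n,j}]^{-1}\hat{\mathcal{Z}}_{n,j}\big|\le\Big[\max_{1\le i\le n}C(|X_i(j)|\delta_{n,j},Y_i)-1+\Big|\frac{\hat{\mathcal{Q}}_{n,j}}{\mathcal{Q}_{n,j}}-1\Big|\Big]\delta_{n,j}.$$ Furthermore, if $$\max_{1\le j\le p}\delta_{n,j}=o_p(1)\quad\text{and}\quad\max_{1\le j\le p}\Big|\frac{\hat{\mathcal{Q}}_{n,j}}{\mathcal{Q}_{n,j}}-1\Big|=o_p(1)\quad\text{as }n\to\infty,$$ then $$\Big|\max_{1\le j\le p}\hat\beta_{n,j}-\max_{1\le j\le p}\beta_{n,j}\Big|\le(1+o_p(1))\max_{1\le j\le p}\Big|\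frac{\hat{\mathcal{Z}}_{n,j}}{\mathcal{Q}_{n,j}}\Big|.$$
   Context: $X_i(j)$ is the $j$-th coordinate of $X_i$; $\ell',\ell''$ are the first and second derivatives of $\ell$ in its first argument. For $u\ge0$, $C(u,y):=\sup_{|s-t|\le u}\ell''(s,y)/\ell''(t,y)$, with $0/0:=1$ and $a/0:=+\infty$ for $a>0$. For $1\le j\le p$, $$\hat{\mathcal{Z}}_{n,j}:=\frac1n\sum_{i=1}^n\ell'(X_i(j)\beta_{n,j},Y_i)h(X_i(j))X_i(j),\qquad\hat{\mathcal{Q}}_{n,j}:=\frac1n\sum_{i=1}^nh(X_i(j))\ell''(X_i(j)\beta_{n,j},Y_i)X_i^2(j),$$ $$\mathcal{Q}_{n,j}:=\frac1n\sum_{i=1}^n\mathbb{E}\big[h(X_i(j))\ell''(X_i(j)\beta_{n,j},Y_i)X_i^2(j)\big],\qquad\delta_{n,j}:=1.5\,[\hat{\mathcal{Q}}_{n,j}]^{-1}|\hat{\mathcal{Z}}_{n,j}|,$$ where $\hat{\mathcal{Q}}_{n,j},\mathcal{Q}_{n,j}$ are assumed non-zero and the minimizers and expectations are assumed to exist. $o_p(1)$ denotes a quantity converging to $0$ in probability as $n\to\infty$.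
   Formalization: The "Furthermore" part additionally assumes max_j max_i C(|X_i(j)|δ_{n,j},Y_i) − 1 = o_p(1); without it the claim fails, since C ≤ 4/3 and max_j δ_{n,j} = o_p(1) do not force C → 1 and the factor can tend to 4/3. *)

theory Defs
  imports "HOL-Probability.Probability"
begin

text \<open>
  The data form a triangular array: for sample size \<open>n\<close> the observations
  \<open>(X n i, Y n i)\<close>, \<open>1 \<le> i \<le> n\<close>, live on a probability space \<open>M n\<close>, and the vector
  \<open>X n i \<omega>\<close> of dimension \<open>p n\<close> is a function of the coordinate index \<open>j \<in> {1..p n}\<close>.
  The loss \<open>l\<close> takes the linear predictor first and the response second.
\<close>

definition loss' :: "(real \<Rightarrow> real \<Rightarrow> real) \<Rightarrow> real \<Rightarrow> real \<Rightarrow> real" where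
  "loss' l s y = deriv (\<lambda>t. l t y) s"

definition loss'' :: "(real \<Rightarrow> real \<Rightarrow> real) \<Rightarrow> real \<Rightarrow> real \<Rightarrow> real" where
  "loss'' l s y = deriv (\<lambda>t. loss' l t y) s"

definition twice_differentiable_loss :: "(real \<Rightarrow> real \<Rightarrow> real) \<Rightarrow> bool" where
  "twice_differentiable_loss l \<longleftrightarrow>
     (\<forall>s y. (\<lambda>t. l t y) differentiable (at s) \<and> (\<lambda>t. loss' l t y) differentiable (at s))"

text \<open>The quotient \<open>a / b\<close> of non-negative reals with \<open>0/0 = 1\<close> and \<open>a/0 = \<infinity>\<close> for \<open>a > 0\<close>.\<close>

definition ratio :: "real \<Rightarrow> real \<Rightarrow> ereal" where
  "ratio a b = (if b = 0 then (if a = 0 then 1 else \<infinity>) else ereal (a / b))"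

definition C_ratio :: "(real \<Rightarrow> real \<Rightarrow> real) \<Rightarrow> real \<Rightarrow> real \<Rightarrow> ereal" where
  "C_ratio l u y = (SUP (s, t) \<in> {(s, t). \<bar>s - t\<bar> \<le> u}. ratio (loss'' l s y) (loss'' l t y))"

definition emp_risk ::
  "(real \<Rightarrow> real \<Rightarrow> real) \<Rightarrow> (real \<Rightarrow> real) \<Rightarrow> (nat \<Rightarrow> nat \<Rightarrow> 'w \<Rightarrow> nat \<Rightarrow> real) \<Rightarrow>
   (nat \<Rightarrow> nat \<Rightarrow> 'w \<Rightarrow> real) \<Rightarrow> nat \<Rightarrow> nat \<Rightarrow> 'w \<Rightarrow> real \<Rightarrow> real" where
  "emp_risk l h X Y n j \<omega> \<theta> =
     1 / real n * (\<Sum>i=1..n. h (X n i \<omega> j) * l (X n i \<omega> j * \<theta>) (Y n i \<omega>))"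

definition pop_risk ::
  "(nat \<Rightarrow> 'w measure) \<Rightarrow> (real \<Rightarrow> real \<Rightarrow> real) \<Rightarrow> (real \<Rightarrow> real) \<Rightarrow>
   (nat \<Rightarrow> nat \<Rightarrow> 'w \<Rightarrow> nat \<Rightarrow> real) \<Rightarrow> (nat \<Rightarrow> nat \<Rightarrow> 'w \<Rightarrow> real) \<Rightarrow>
   nat \<Rightarrow> nat \<Rightarrow> real \<Rightarrow> real" where
  "pop_risk M l h X Y n j \<theta> =
     1 / real n * (\<Sum>i=1..n. \<integral>\<omega>. h (X n i \<omega> j) * l (X n i \<omega> j * \<theta>) (Y n i \<omega>) \<partial>M n)"

definition Z_hat ::
  "(real \<Rightarrow> real \<Rightarrow> real) \<Rightarrow> (real \<Rightarrow> real) \<Rightarrow> (nat \<Rightarrow> nat \<Rightarrow> 'w \<Rightarrow> nat \<Rightarrow> real) \<Rightarrow>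
   (nat \<Rightarrow> nat \<Rightarrow> 'w \<Rightarrow> real) \<Rightarrow> (nat \<Rightarrow> nat \<Rightarrow> real) \<Rightarrow> nat \<Rightarrow> nat \<Rightarrow> 'w \<Rightarrow> real" where
  "Z_hat l h X Y \<beta> n j \<omega> =
     1 / real n * (\<Sum>i=1..n. loss' l (X n i \<omega> j * \<beta> n j) (Y n i \<omega>) * h (X n i \<omega> j) * X n i \<omega> j)"

definition Q_hat ::
  "(real \<Rightarrow> real \<Rightarrow> real) \<Rightarrow> (real \<Rightarrow> real) \<Rightarrow> (nat \<Rightarrow> nat \<Rightarrow> 'w \<Rightarrow> nat \<Rightarrow> real) \<Rightarrow>
   (nat \<Rightarrow> nat \<Rightarrow> 'w \<Rightarrow> real) \<Rightarrow> (nat \<Rightarrow> nat \<Rightarrow> real) \<Rightarrow> nat \<Rightarrow> nat \<Rightarrow> 'w \<Rightarrow> real" where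
  "Q_hat l h X Y \<beta> n j \<omega> =
     1 / real n *
       (\<Sum>i=1..n. h (X n i \<omega> j) * loss'' l (X n i \<omega> j * \<beta> n j) (Y n i \<omega>) * (X n i \<omega> j)\<^sup>2)"

definition Q_pop ::
  "(nat \<Rightarrow> 'w measure) \<Rightarrow> (real \<Rightarrow> real \<Rightarrow> real) \<Rightarrow> (real \<Rightarrow> real) \<Rightarrow>
   (nat \<Rightarrow> nat \<Rightarrow> 'w \<Rightarrow> nat \<Rightarrow> real) \<Rightarrow> (nat \<Rightarrow> nat \<Rightarrow> 'w \<Rightarrow> real) \<Rightarrow> (nat \<Rightarrow> nat \<Rightarrow> real) \<Rightarrow>
   nat \<Rightarrow> nat \<Rightarrow> real" where
  "Q_pop M l h X Y \<beta> n j =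
     1 / real n *
       (\<Sum>i=1..n. \<integral>\<omega>. h (X n i \<omega> j) * loss'' l (X n i \<omega> j * \<beta> n j) (Y n i \<omega>) * (X n i \<omega> j)\<^sup>2 \<partial>M n)"

definition delta ::
  "(real \<Rightarrow> real \<Rightarrow> real) \<Rightarrow> (real \<Rightarrow> real) \<Rightarrow> (nat \<Rightarrow> nat \<Rightarrow> 'w \<Rightarrow> nat \<Rightarrow> real) \<Rightarrow>
   (nat \<Rightarrow> nat \<Rightarrow> 'w \<Rightarrow> real) \<Rightarrow> (nat \<Rightarrow> nat \<Rightarrow> real) \<Rightarrow> nat \<Rightarrow> nat \<Rightarrow> 'w \<Rightarrow> real" where
  "delta l h X Y \<beta> n j \<omega> = 1.5 * inverse (Q_hat l h X Y \<beta> n j \<omega>) * \<bar>Z_hat l h X Y \<beta> n j \<omega>\<bar>"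

definition C_max ::
  "(real \<Rightarrow> real \<Rightarrow> real) \<Rightarrow> (real \<Rightarrow> real) \<Rightarrow> (nat \<Rightarrow> nat \<Rightarrow> 'w \<Rightarrow> nat \<Rightarrow> real) \<Rightarrow>
   (nat \<Rightarrow> nat \<Rightarrow> 'w \<Rightarrow> real) \<Rightarrow> (nat \<Rightarrow> nat \<Rightarrow> real) \<Rightarrow> nat \<Rightarrow> nat \<Rightarrow> 'w \<Rightarrow> ereal" where
  "C_max l h X Y \<beta> n j \<omega> =
     (MAX i\<in>{1..n}. C_ratio l (\<bar>X n i \<omega> j\<bar> * delta l h X Y \<beta> n j \<omega>) (Y n i \<omega>))"

text \<open>
  The second half of the corollary takes \<open>max\<^sub>j C_max - 1 = o\<^sub>p(1)\<close> as a hypothesis. It makes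
  explicit what the passage from \<open>\<delta> \<rightarrow> 0\<close> to a factor \<open>1 + o\<^sub>p(1)\<close> uses: \<open>C_max \<le> 4/3\<close> together with
  \<open>max\<^sub>j \<delta> = o\<^sub>p(1)\<close> does not bound the factor below 4/3. Take \<open>X = h = p = 1\<close>,
  \<open>loss' l t y = 3 * t - y + y\<^sup>2 * arctan (t / y\<^sup>2)\<close> and \<open>Y n i = \<plusminus> 1/n\<close> with one fair sign for all \<open>i\<close>.
\<close>

text \<open>
  \<open>T n = o\<^sub>p(1)\<close>. For measurable \<open>T n\<close> the outer measure is the measure, and this is the usual
  convergence to 0 in probability. Extended real values and non-measurable \<open>T n\<close> are allowed because
  \<open>C_max\<close> may be infinite and is a supremum over an uncountable set.
\<close>

definition op1 :: "(nat \<Rightarrow> 'w measure) \<Rightarrow> (nat \<Rightarrow> 'w \<Rightarrow> ereal) \<Rightarrow> bool" where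
  "op1 M T \<longleftrightarrow>
     (\<forall>\<epsilon>>0. (\<lambda>n. outer_measure_of (M n) {\<omega> \<in> space (M n). ereal \<epsilon> < \<bar>T n \<omega>\<bar>}) \<longlonglongrightarrow> 0)"

end

theory Submission
  imports Defs
begin

text \<open>
  The empirical gradient is non-decreasing, and within \<open>\<delta>\<close> of \<open>\<beta>\<close> its derivative lies between
  \<open>Q / c\<close> and \<open>c Q\<close>, where \<open>Q\<close> is its derivative at \<open>\<beta>\<close> and \<open>c \<le> 4 / 3\<close>. Since \<open>\<delta> = 1.5 \<bar>Z\<bar> / Q\<close>
  and \<open>1.5 / c > 1\<close>, the gradient changes sign within \<open>\<delta>\<close> of \<open>\<beta>\<close>, so the minimizer lies there and
  the mean value theorem gives \<open>\<beta>hat - \<beta> = - Z / (r Q)\<close> with \<open>1 / c \<le> r \<le> c\<close>. Both claims follow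
  from this identity by elementary algebra.
\<close>

section \<open>Locating the zero of a non-decreasing real function\<close>

lemma gradient_root_le:
  fixes f g :: "real \<Rightarrow> real"
  assumes deriv: "\<And>t. (f has_real_derivative g t) (at t)"
    and nonneg: "\<And>t. g t \<ge> 0"
    and root: "f z = 0"
    and pos: "g b > 0"
    and near: "\<And>t. \<bar>t - b\<bar> \<le> 3 / 2 * \<bar>f b\<bar> / g b \<Longrightarrow> 3 / 4 * g b \<le> g t"
  shows "z \<le> b + 3 / 2 * \<bar>f b\<bar> / g b"
proof (rule ccontr)
  define d where "d = 3 / 2 * \<bar>f b\<bar> / g b"
  assume "\<not> z \<le> b + 3 / 2 * \<bar>f b\<bar> / g b"
  hence z: "b + d < z"
    by (simp add: d_def)
  have d_nonneg: "d \<ge> 0"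
    using pos by (simp add: d_def)
  have f_mono: "f s \<le> f t" if "s \<le> t" for s t
    using DERIV_nonneg_imp_nondecreasing[OF that, of f] deriv nonneg by blast
  show False
  proof (cases "f b = 0")
    \<comment> \<open>Here \<open>d = 0\<close>, so the mean value theorem has no interval to work
      on. The positive derivative at \<open>b\<close> makes \<open>f\<close> grow strictly just to
      the right of \<open>b\<close>; the \<open>min\<close> picks a point in that range that does
      not pass \<open>z\<close>, and monotonicity then gives \<open>f z > 0\<close>.\<close>
    case True
    obtain e where e: "e > 0" "\<And>u. 0 < u \<Longrightarrow> u < e \<Longrightarrow> f b < f (b + u)"
      using DERIV_pos_inc_right[OF deriv pos] by blast
    have "b < z"
      using z d_nonneg by simp
    then have "f b < f (b + min (e / 2) (z - b))"
      using e(1) by (intro e(2)) auto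
    also have "\<dots> \<le> f z"
      by (rule f_mono) auto
    finally show False
      using root True by simp
  next
    case False
    then have "d > 0"
      using pos by (simp add: d_def)
    then obtain t where t: "b < t" "t < b + d" "f (b + d) - f b = d * g t"
      using MVT2[of b "b + d" f g] deriv by auto
    have "3 / 4 * g b \<le> g t"
      using t(1,2) by (intro near) (auto simp: d_def)
    then have "d * (3 / 4 * g b) \<le> d * g t"
      using d_nonneg by (rule mult_left_mono)
    \<comment> \<open>The product \<open>3 / 2 * 3 / 4 = 9 / 8\<close> exceeds 1. Hence
      \<open>f (b + d) \<ge> f b + 9 / 8 * \<bar>f b\<bar> > 0\<close> whatever the sign of
      \<open>f b\<close>, and a zero beyond \<open>b + d\<close> is impossible.\<close>
    moreover have "d * (3 / 4 * g b) = 9 / 8 * \<bar>f b\<bar>"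
      using pos by (simp add: d_def)
    moreover have "f (b + d) \<le> f z"
      using z by (intro f_mono) simp
    ultimately show False
      using t(3) root False by simp
  qed
qed

text \<open>The lower bound on \<open>z\<close> is the upper bound for the reflected function
  \<open>\<lambda>t. - f (- t)\<close>, which is again non-decreasing and has derivative
  \<open>g (- t)\<close>.\<close>

lemma gradient_root_dist_le:
  fixes f g :: "real \<Rightarrow> real"
  assumes deriv: "\<And>t. (f has_real_derivative g t) (at t)"
    and nonneg: "\<And>t. g t \<ge> 0"
    and root: "f z = 0"
    and pos: "g b > 0"
    and near: "\<And>t. \<bar>t - b\<bar> \<le> 3 / 2 * \<bar>f b\<bar> / g b \<Longrightarrow> 3 / 4 * g b \<le> g t"
  shows "\<bar>z - b\<bar> \<le> 3 / 2 * \<bar>f b\<bar> / g b"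
proof -
  have "z \<le> b + 3 / 2 * \<bar>f b\<bar> / g b"
    using assms by (rule gradient_root_le)
  moreover have "- z \<le> - b + 3 / 2 * \<bar>- f (- (- b))\<bar> / g (- (- b))"
  proof (rule gradient_root_le[where f = "\<lambda>t. - f (- t)" and g = "\<lambda>t. g (- t)"])
    show "((\<lambda>t. - f (- t)) has_real_derivative g (- t)) (at t)" for t
      using DERIV_minus[OF deriv[of "- t", unfolded DERIV_mirror]] by simp
    show "3 / 4 * g (- (- b)) \<le> g (- t)"
      if "\<bar>t - (- b)\<bar> \<le> 3 / 2 * \<bar>- f (- (- b))\<bar> / g (- (- b))" for t
      using near[of "- t"] that abs_minus_cancel[of "t + b"] by simp
  qed (use nonneg root pos in auto)
  ultimately show ?thesis
    by (simp add: abs_le_iff)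
qed

text \<open>The cap 4/3 on \<open>c\<close> supplies the lower bound
  \<open>3 / 4 * g b \<le> g t\<close> that confines the zero to the region where
  \<open>near\<close> applies. The mean value theorem between \<open>z\<close> and \<open>b\<close>
  then yields a point \<open>t\<close> of that region, and \<open>r = g t / g b\<close> is the
  relative slope there.\<close>

lemma gradient_root_eq:
  fixes f g :: "real \<Rightarrow> real"
  assumes deriv: "\<And>t. (f has_real_derivative g t) (at t)"
    and nonneg: "\<And>t. g t \<ge> 0"
    and root: "f z = 0"
    and pos: "g b > 0"
    and c: "1 \<le> c" "c \<le> 4 / 3"
    and near: "\<And>t. \<bar>t - b\<bar> \<le> 3 / 2 * \<bar>f b\<bar> / g b \<Longrightarrow> g b \<le> c * g t \<and> g t \<le> c * g b"
  obtains r where "1 / c \<le> r" "r \<le> c" "z - b = - f b / (r * g b)"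
proof -
  have near': "3 / 4 * g b \<le> g t" if "\<bar>t - b\<bar> \<le> 3 / 2 * \<bar>f b\<bar> / g b" for t
  proof -
    have "g b \<le> c * g t"
      using near that by blast
    also have "\<dots> \<le> 4 / 3 * g t"
      using c nonneg by (intro mult_right_mono) auto
    finally show ?thesis
      by simp
  qed
  have dist: "\<bar>z - b\<bar> \<le> 3 / 2 * \<bar>f b\<bar> / g b"
    using deriv nonneg root pos near' by (rule gradient_root_dist_le)
  obtain t where t: "\<bar>t - b\<bar> \<le> \<bar>z - b\<bar>" "f z - f b = (z - b) * g t"
  proof (cases z b rule: linorder_cases)
    case less
    then obtain t where "z < t" "t < b" "f b - f z = (b - z) * g t"
      using MVT2[of z b f g] deriv by blast
    then show ?thesis
      by (intro that[of t]) (auto simp: algebra_simps)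
  next
    case greater
    then obtain t where "b < t" "t < z" "f z - f b = (z - b) * g t"
      using MVT2[of b z f g] deriv by blast
    then show ?thesis
      by (intro that[of t]) auto
  qed (use that[of b] in simp)
  have bnd: "g b \<le> c * g t" "g t \<le> c * g b" and "3 / 4 * g b \<le> g t"
    using near[of t] near'[of t] t(1) dist by auto
  with pos have "g t > 0"
    by simp
  show ?thesis
  proof (rule that[of "g t / g b"])
    show "1 / c \<le> g t / g b" "g t / g b \<le> c"
      using bnd pos c by (auto simp: field_simps)
    show "z - b = - f b / (g t / g b * g b)"
      using t(2) root pos \<open>g t > 0\<close> by (simp add: field_simps)
  qed
qed

section \<open>Curvature of the loss and its ratio bound\<close>

lemma loss_deriv:
  assumes "twice_differentiable_loss l"
  shows "((\<lambda>t. l t y) has_real_derivative loss' l s y) (at s)"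
    and "((\<lambda>t. loss' l t y) has_real_derivative loss'' l s y) (at s)"
  using assms
  by (auto simp: twice_differentiable_loss_def loss'_def loss''_def DERIV_deriv_iff_real_differentiable)

text \<open>A convex graph lies above its tangents. Adding the tangent inequalities at
  \<open>s\<close> and at \<open>t\<close> shows that the first derivative is monotone.\<close>

lemma loss''_nonneg:
  assumes diff: "twice_differentiable_loss l" and convex: "convex_on UNIV (\<lambda>t. l t y)"
  shows "loss'' l s y \<ge> 0"
proof (rule mono_on_imp_deriv_nonneg[OF _ loss_deriv(2)[OF diff]])
  have tangent: "l t y - l s y \<ge> loss' l s y * (t - s)" for s t
    using convex_on_imp_above_tangent[OF convex, of s t] loss_deriv(1)[OF diff] by auto
  show "mono_on UNIV (\<lambda>t. loss' l t y)"
  proof (rule mono_onI)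
    fix s t :: real
    assume "s \<le> t"
    have "0 \<le> (loss' l t y - loss' l s y) * (t - s)"
      using tangent[of s t] tangent[of t s] by (simp add: algebra_simps)
    then show "loss' l s y \<le> loss' l t y"
      using \<open>s \<le> t\<close> by (cases "s = t") (auto simp: zero_le_mult_iff)
  qed
qed simp

text \<open>The pair \<open>(0, 0)\<close> is admissible in the supremum and contributes 1, thanks
  to the convention 0/0 = 1 if the curvature vanishes at 0.\<close>

lemma C_ratio_ge_1:
  assumes "u \<ge> 0"
  shows "1 \<le> C_ratio l u y"
  unfolding C_ratio_def
  by (rule SUP_upper2[of "(0, 0)"]) (use assms in \<open>auto simp: ratio_def one_ereal_def\<close>)

text \<open>A finite bound excludes the value \<infinity> of \<open>ratio\<close>: where the
  curvature at \<open>t\<close> is zero, so is the curvature at \<open>s\<close>. Elsewhere the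
  quotient bound is multiplied out.\<close>

lemma loss''_le_C_ratio:
  assumes "C_ratio l u y \<le> ereal c" "\<bar>s - t\<bar> \<le> u" "loss'' l t y \<ge> 0"
  shows "loss'' l s y \<le> c * loss'' l t y"
proof -
  have "ratio (loss'' l s y) (loss'' l t y) \<le> C_ratio l u y"
    unfolding C_ratio_def by (rule SUP_upper2[of "(s, t)"]) (use assms in auto)
  then have "ratio (loss'' l s y) (loss'' l t y) \<le> ereal c"
    using assms by simp
  then show ?thesis
    using assms(3) by (auto simp: ratio_def field_simps split: if_splits)
qed

section \<open>The empirical minimizer in one coordinate: expansion and error bound\<close>

lemma betahat_expansion:
  fixes X :: "nat \<Rightarrow> nat \<Rightarrow> 'w \<Rightarrow> nat \<Rightarrow> real"
  assumes n: "n \<ge> 1"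
    and diff: "twice_differentiable_loss l"
    and convex: "\<And>y. convex_on UNIV (\<lambda>t. l t y)"
    and h: "\<And>x. h x \<ge> 0"
    and argmin: "is_arg_min (emp_risk l h X Y n j \<omega>) (\<lambda>_. True) z"
    and Q: "Q_hat l h X Y \<beta> n j \<omega> \<noteq> 0"
    and C: "C_max l h X Y \<beta> n j \<omega> \<le> ereal (4 / 3)"
  obtains c r where "C_max l h X Y \<beta> n j \<omega> = ereal c" "1 \<le> c" "1 / c \<le> r" "r \<le> c"
    "Q_hat l h X Y \<beta> n j \<omega> > 0"
    "z - \<beta> n j = - Z_hat l h X Y \<beta> n j \<omega> / (r * Q_hat l h X Y \<beta> n j \<omega>)"
proof -
  define x y where "x = (\<lambda>i. X n i \<omega> j)" and "y = (\<lambda>i. Y n i \<omega>)"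
  define f where "f t = 1 / real n * (\<Sum>i=1..n. loss' l (x i * t) (y i) * h (x i) * x i)" for t
  define g where "g t = 1 / real n * (\<Sum>i=1..n. h (x i) * loss'' l (x i * t) (y i) * (x i)\<^sup>2)" for t
  define b where "b = \<beta> n j"
  define d where "d = delta l h X Y \<beta> n j \<omega>"
  have f_b: "f b = Z_hat l h X Y \<beta> n j \<omega>" and g_b: "g b = Q_hat l h X Y \<beta> n j \<omega>"
    by (simp_all add: f_def g_def b_def x_def y_def Z_hat_def Q_hat_def)
  note l''_nonneg = loss''_nonneg[OF diff convex]
  have g_nonneg: "g t \<ge> 0" for t
    unfolding g_def by (intro mult_nonneg_nonneg sum_nonneg l''_nonneg h) auto
  then have g_pos: "g b > 0"
    using Q g_b by (metis order_le_less)
  have d_eq: "d = 3 / 2 * \<bar>f b\<bar> / g b"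
    by (simp add: d_def delta_def f_b g_b field_simps)
  have "d \<ge> 0"
    using g_pos by (simp add: d_eq)
  have f_deriv: "(f has_real_derivative g t) (at t)" for t
    unfolding f_def[abs_def] g_def using n
    by (auto intro!: derivative_eq_intros DERIV_chain2[OF loss_deriv(2)[OF diff]] sum.cong
        simp: power2_eq_square algebra_simps)
  \<comment> \<open>First-order condition: \<open>f\<close> is the derivative of the empirical risk.
    The minimum is global, so the neighbourhood radius 1 is an arbitrary choice.\<close>
  have "(emp_risk l h X Y n j \<omega> has_real_derivative f z) (at z)"
    unfolding emp_risk_def[abs_def] f_def x_def y_def using n
    by (auto intro!: derivative_eq_intros DERIV_chain2[OF loss_deriv(1)[OF diff]] sum.cong
        simp: algebra_simps)
  then have root: "f z = 0"
    by (rule DERIV_local_min[where d = 1])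
      (use argmin in \<open>auto simp: is_arg_min_def not_less\<close>)
  have C_le: "C_ratio l (\<bar>x i\<bar> * d) (y i) \<le> C_max l h X Y \<beta> n j \<omega>" if "i \<in> {1..n}" for i
    unfolding C_max_def x_def y_def d_def using that by (intro Max_ge) auto
  have C_ge: "1 \<le> C_max l h X Y \<beta> n j \<omega>"
    using C_ratio_ge_1[of "\<bar>x 1\<bar> * d" l "y 1"] C_le[of 1] n \<open>d \<ge> 0\<close> by force
  \<comment> \<open>The lower bound 1 rules out -\<infinity> and the upper bound 4/3 rules out
    \<infinity>, so real arithmetic can take over.\<close>
  obtain c where c: "C_max l h X Y \<beta> n j \<omega> = ereal c"
    using C C_ge by (cases "C_max l h X Y \<beta> n j \<omega>") auto
  have c_bnds: "1 \<le> c" "c \<le> 4 / 3"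
    using C C_ge by (simp_all add: c one_ereal_def)
  \<comment> \<open>Moving the parameter by at most \<open>d\<close> moves the i-th linear predictor
    by at most \<open>\<bar>x i\<bar> * d\<close>, the radius used in \<open>C_max\<close>. The
    termwise bounds are summed with the non-negative weights \<open>h (x i) * (x i)\<^sup>2\<close>.
    Exchanging \<open>s\<close> and \<open>t\<close> makes the estimate two-sided.\<close>
  have g_le: "g s \<le> c * g t" if "\<bar>s - t\<bar> \<le> d" for s t
  proof -
    have "loss'' l (x i * s) (y i) \<le> c * loss'' l (x i * t) (y i)" if "i \<in> {1..n}" for i
    proof (rule loss''_le_C_ratio)
      show "C_ratio l (\<bar>x i\<bar> * d) (y i) \<le> ereal c"
        using C_le[OF that] c by simp
      show "\<bar>x i * s - x i * t\<bar> \<le> \<bar>x i\<bar> * d"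
        using \<open>\<bar>s - t\<bar> \<le> d\<close> by (simp flip: right_diff_distrib add: abs_mult mult_left_mono)
    qed (rule l''_nonneg)
    then have "(\<Sum>i=1..n. h (x i) * loss'' l (x i * s) (y i) * (x i)\<^sup>2)
        \<le> (\<Sum>i=1..n. h (x i) * (c * loss'' l (x i * t) (y i)) * (x i)\<^sup>2)"
      by (intro sum_mono mult_right_mono mult_left_mono h) auto
    also have "\<dots> = c * (\<Sum>i=1..n. h (x i) * loss'' l (x i * t) (y i) * (x i)\<^sup>2)"
      by (simp add: sum_distrib_left ac_simps)
    finally show ?thesis
      using n by (simp add: g_def divide_right_mono)
  qed
  have near: "g b \<le> c * g t \<and> g t \<le> c * g b" if "\<bar>t - b\<bar> \<le> 3 / 2 * \<bar>f b\<bar> / g b" for t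
    using g_le[of b t] g_le[of t b] that by (simp add: d_eq abs_minus_commute)
  obtain r where "1 / c \<le> r" "r \<le> c" "z - b = - f b / (r * g b)"
    using gradient_root_eq[OF f_deriv g_nonneg root g_pos c_bnds near] by blast
  then show ?thesis
    using that[of c r] c c_bnds g_pos by (simp add: b_def flip: f_b g_b)
qed

text \<open>The error factors as \<open>(q / Q - 1 / r) * (Z / q)\<close>. Since
  \<open>1 / r\<close> lies between \<open>1 / c\<close> and \<open>c\<close>, its distance from 1
  is at most \<open>c - 1\<close>, and the triangle inequality through 1 bounds the first factor.
  The factor 3/2 on the right is slack.\<close>

lemma expansion_error_le:
  fixes c r q Q Z b z :: real
  assumes "1 \<le> c" "1 / c \<le> r" "r \<le> c" "q > 0" "z - b = - Z / (r * q)" "Q \<noteq> 0"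
  shows "\<bar>z - b + inverse Q * Z\<bar> \<le> (c - 1 + \<bar>q / Q - 1\<bar>) * (3 / 2 * inverse q * \<bar>Z\<bar>)"
proof -
  have "0 < 1 / c" using assms by simp
  then have r: "r > 0" using assms by linarith
  have "1 / r \<le> c"
    using assms r by (simp add: field_simps)
  moreover have "1 / c \<le> 1 / r"
    using assms r by (simp add: frac_le)
  moreover have "1 - 1 / c \<le> c - 1"
  proof -
    \<comment> \<open>This square is exactly the difference of the two sides,
      \<open>c - 1 - (1 - 1 / c)\<close>.\<close>
    have "0 \<le> (c - 1)\<^sup>2 / c" using assms by simp
    also have "(c - 1)\<^sup>2 / c = c - 2 + 1 / c"
      using assms by (simp add: field_simps power2_eq_square)
    finally show ?thesis by simp
  qed
  ultimately have le: "\<bar>q / Q - 1 / r\<bar> \<le> c - 1 + \<bar>q / Q - 1\<bar>"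
    by linarith
  have "z - b + inverse Q * Z = (q / Q - 1 / r) * (inverse q * Z)"
    unfolding assms(5) using assms(4,6) r by (simp add: field_simps)
  then have "\<bar>z - b + inverse Q * Z\<bar> = \<bar>q / Q - 1 / r\<bar> * (inverse q * \<bar>Z\<bar>)"
    using assms by (simp add: abs_mult)
  also have "\<dots> \<le> (c - 1 + \<bar>q / Q - 1\<bar>) * (3 / 2 * inverse q * \<bar>Z\<bar>)"
  proof (rule mult_mono[OF le])
    have "0 \<le> inverse q * \<bar>Z\<bar>" using assms by simp
    then show "inverse q * \<bar>Z\<bar> \<le> 3 / 2 * inverse q * \<bar>Z\<bar>" by linarith
  qed (use assms in auto)
  finally show ?thesis .
qed

section \<open>Comparison of maxima and calculus of \<open>op1\<close>\<close>

lemma abs_Max_diff_le: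
  fixes f g :: "'a \<Rightarrow> real"
  assumes "finite A" "A \<noteq> {}" "\<And>a. a \<in> A \<Longrightarrow> \<bar>f a - g a\<bar> \<le> e"
  shows "\<bar>(MAX a\<in>A. f a) - (MAX a\<in>A. g a)\<bar> \<le> e"
proof -
  \<comment> \<open>The one-sided estimate is proved for arbitrary \<open>f\<close> and
    \<open>g\<close>, so that exchanging them gives the other side.\<close>
  have "(MAX a\<in>A. f a) \<le> (MAX a\<in>A. g a) + e"
    if near: "\<And>a. a \<in> A \<Longrightarrow> \<bar>f a - g a\<bar> \<le> e" for f g :: "'a \<Rightarrow> real"
  proof -
    have "f a \<le> (MAX a\<in>A. g a) + e" if a: "a \<in> A" for a
    proof -
      have "g a \<le> (MAX a\<in>A. g a)"
        using assms(1) a by (intro Max_ge) auto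
      then show ?thesis
        using near[OF a] by linarith
    qed
    then show ?thesis using assms(1,2) by simp
  qed
  from this[of f g] this[of g f] assms(3) show ?thesis
    by (fastforce simp: abs_minus_commute abs_le_iff)
qed

text \<open>The events in \<open>op1\<close> need not be measurable. Measurable hulls of equal outer
  measure reduce the claim to subadditivity of the measure.\<close>

lemma outer_measure_of_Un_le:
  assumes "A \<subseteq> space M" "B \<subseteq> space M"
  shows "outer_measure_of M (A \<union> B) \<le> outer_measure_of M A + outer_measure_of M B"
proof -
  obtain E F where E: "E \<in> sets M" "A \<subseteq> E" "outer_measure_of M A = emeasure M E"
    and F: "F \<in> sets M" "B \<subseteq> F" "outer_measure_of M B = emeasure M F"
    using outer_measure_of_attain assms by metis
  have "outer_measure_of M (A \<union> B) \<le> outer_measure_of M (E \<union> F)"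
    using E F by (intro outer_measure_of_mono) auto
  also have "\<dots> = emeasure M (E \<union> F)" using E F by simp
  also have "\<dots> \<le> emeasure M E + emeasure M F" using E F by (intro emeasure_subadditive)
  finally show ?thesis using E F by simp
qed

text \<open>The event that \<open>U\<close> exceeds \<epsilon> is covered by the events that
  \<open>S\<close> or \<open>T\<close> exceeds \<eta>. As \<eta> depends on \<epsilon> alone, the
  outer measures of the two covering events tend to 0 and squeeze the third.\<close>

lemma op1_dominated:
  assumes S: "op1 M S" and T: "op1 M T"
    and le: "\<And>\<epsilon>. \<epsilon> > 0 \<Longrightarrow> \<exists>\<eta>>0. \<forall>n\<ge>1. \<forall>\<omega>\<in>space (M n).
      \<bar>S n \<omega>\<bar> \<le> ereal \<eta> \<longrightarrow> \<bar>T n \<omega>\<bar> \<le> ereal \<eta> \<longrightarrow> \<bar>U n \<omega>\<bar> \<le> ereal \<epsilon>"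
  shows "op1 M U"
  unfolding op1_def
proof (intro allI impI)
  fix \<epsilon> :: real
  assume "\<epsilon> > 0"
  then obtain \<eta> where \<eta>: "\<eta> > 0" "\<And>n \<omega>. n \<ge> 1 \<Longrightarrow> \<omega> \<in> space (M n) \<Longrightarrow>
      \<bar>S n \<omega>\<bar> \<le> ereal \<eta> \<Longrightarrow> \<bar>T n \<omega>\<bar> \<le> ereal \<eta> \<Longrightarrow> \<bar>U n \<omega>\<bar> \<le> ereal \<epsilon>"
    using le by meson
  define exc where "exc V e n = {\<omega> \<in> space (M n). ereal e < \<bar>V n \<omega>\<bar>}"
    for V :: "nat \<Rightarrow> 'a \<Rightarrow> ereal" and e n
  have "(\<lambda>n. outer_measure_of (M n) (exc S \<eta> n) + outer_measure_of (M n) (exc T \<eta> n)) \<longlonglongrightarrow> 0 + 0"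
    using S T \<eta>(1) unfolding op1_def exc_def by (intro tendsto_add) auto
  moreover have "eventually (\<lambda>n. outer_measure_of (M n) (exc U \<epsilon> n)
      \<le> outer_measure_of (M n) (exc S \<eta> n) + outer_measure_of (M n) (exc T \<eta> n)) sequentially"
    using eventually_ge_at_top[of 1]
  proof eventually_elim
    case (elim n)
    have "exc U \<epsilon> n \<subseteq> exc S \<eta> n \<union> exc T \<eta> n"
      using \<eta>(2)[OF elim] by (force simp: exc_def not_less[symmetric])
    then have "outer_measure_of (M n) (exc U \<epsilon> n) \<le> outer_measure_of (M n) (exc S \<eta> n \<union> exc T \<eta> n)"
      by (rule outer_measure_of_mono)
    also have "\<dots> \<le> outer_measure_of (M n) (exc S \<eta> n) + outer_measure_of (M n) (exc T \<eta> n)"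
      by (rule outer_measure_of_Un_le) (auto simp: exc_def)
    finally show ?case .
  qed
  ultimately show "(\<lambda>n. outer_measure_of (M n) {\<omega> \<in> space (M n). ereal \<epsilon> < \<bar>U n \<omega>\<bar>}) \<longlonglongrightarrow> 0"
    unfolding exc_def[symmetric]
    by (auto intro: tendsto_sandwich[where f = "\<lambda>_. 0", OF _ _ tendsto_const])
qed

section \<open>The simultaneous bound and the comparison of maxima\<close>

theorem corollary7p3:
  fixes M :: "nat \<Rightarrow> 'w measure"
    and p :: "nat \<Rightarrow> nat"
    and X :: "nat \<Rightarrow> nat \<Rightarrow> 'w \<Rightarrow> nat \<Rightarrow> real"
    and Y :: "nat \<Rightarrow> nat \<Rightarrow> 'w \<Rightarrow> real"
    and l :: "real \<Rightarrow> real \<Rightarrow> real"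
    and h :: "real \<Rightarrow> real"
    and \<beta> :: "nat \<Rightarrow> nat \<Rightarrow> real"
    and \<beta>hat :: "nat \<Rightarrow> nat \<Rightarrow> 'w \<Rightarrow> real"
  assumes prob: "\<And>n. n \<ge> 1 \<Longrightarrow> prob_space (M n)"
    and dim: "\<And>n. n \<ge> 1 \<Longrightarrow> p n \<ge> 1"
    and X_rv: "\<And>n i j. n \<ge> 1 \<Longrightarrow> i \<in> {1..n} \<Longrightarrow> j \<in> {1..p n} \<Longrightarrow>
                 (\<lambda>\<omega>. X n i \<omega> j) \<in> borel_measurable (M n)"
    and Y_rv: "\<And>n i. n \<ge> 1 \<Longrightarrow> i \<in> {1..n} \<Longrightarrow> Y n i \<in> borel_measurable (M n)"
    and l_diff: "twice_differentiable_loss l"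
    and l_convex: "\<And>y. convex_on UNIV (\<lambda>t. l t y)"
    and h_nonneg: "\<And>x. h x \<ge> 0"
    and risk_integrable: "\<And>n i j \<theta>. n \<ge> 1 \<Longrightarrow> i \<in> {1..n} \<Longrightarrow> j \<in> {1..p n} \<Longrightarrow>
          integrable (M n) (\<lambda>\<omega>. h (X n i \<omega> j) * l (X n i \<omega> j * \<theta>) (Y n i \<omega>))"
    and curvature_integrable: "\<And>n i j. n \<ge> 1 \<Longrightarrow> i \<in> {1..n} \<Longrightarrow> j \<in> {1..p n} \<Longrightarrow>
          integrable (M n)
            (\<lambda>\<omega>. h (X n i \<omega> j) * loss'' l (X n i \<omega> j * \<beta> n j) (Y n i \<omega>) * (X n i \<omega> j)\<^sup>2)"
    and \<beta>_argmin: "\<And>n j. n \<ge> 1 \<Longrightarrow> j \<in> {1..p n} \<Longrightarrow>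
          is_arg_min (pop_risk M l h X Y n j) (\<lambda>_. True) (\<beta> n j)"
    and \<beta>hat_argmin: "\<And>n j \<omega>. n \<ge> 1 \<Longrightarrow> j \<in> {1..p n} \<Longrightarrow> \<omega> \<in> space (M n) \<Longrightarrow>
          is_arg_min (emp_risk l h X Y n j \<omega>) (\<lambda>_. True) (\<beta>hat n j \<omega>)"
    and Q_hat_nz: "\<And>n j \<omega>. n \<ge> 1 \<Longrightarrow> j \<in> {1..p n} \<Longrightarrow> \<omega> \<in> space (M n) \<Longrightarrow>
          Q_hat l h X Y \<beta> n j \<omega> \<noteq> 0"
    and Q_pop_nz: "\<And>n j. n \<ge> 1 \<Longrightarrow> j \<in> {1..p n} \<Longrightarrow> Q_pop M l h X Y \<beta> n j \<noteq> 0"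
  shows
    "(\<forall>n\<ge>1. \<forall>\<omega>\<in>space (M n).
        (MAX j\<in>{1..p n}. C_max l h X Y \<beta> n j \<omega>) \<le> ereal (4 / 3) \<longrightarrow>
        (\<forall>j\<in>{1..p n}.
           ereal \<bar>\<beta>hat n j \<omega> - \<beta> n j + inverse (Q_pop M l h X Y \<beta> n j) * Z_hat l h X Y \<beta> n j \<omega>\<bar>
           \<le> (C_max l h X Y \<beta> n j \<omega> - 1
               + ereal \<bar>Q_hat l h X Y \<beta> n j \<omega> / Q_pop M l h X Y \<beta> n j - 1\<bar>)
             * ereal (delta l h X Y \<beta> n j \<omega>)))
     \<and>
     (op1 M (\<lambda>n \<omega>. ereal (MAX j\<in>{1..p n}. delta l h X Y \<beta> n j \<omega>)) \<longrightarrow>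
      op1 M (\<lambda>n \<omega>. ereal (MAX j\<in>{1..p n}.
                 \<bar>Q_hat l h X Y \<beta> n j \<omega> / Q_pop M l h X Y \<beta> n j - 1\<bar>)) \<longrightarrow>
      op1 M (\<lambda>n \<omega>. (MAX j\<in>{1..p n}. C_max l h X Y \<beta> n j \<omega>) - 1) \<longrightarrow>
      (\<exists>R :: nat \<Rightarrow> 'w \<Rightarrow> real.
         op1 M (\<lambda>n \<omega>. ereal (R n \<omega>)) \<and>
         (\<forall>n\<ge>1. \<forall>\<omega>\<in>space (M n).
            (MAX j\<in>{1..p n}. C_max l h X Y \<beta> n j \<omega>) \<le> ereal (4 / 3) \<longrightarrow>
            \<bar>(MAX j\<in>{1..p n}. \<beta>hat n j \<omega>) - (MAX j\<in>{1..p n}. \<beta> n j)\<bar>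
            \<le> (1 + R n \<omega>) *
               (MAX j\<in>{1..p n}. \<bar>Z_hat l h X Y \<beta> n j \<omega> / Q_pop M l h X Y \<beta> n j\<bar>))))"
proof -
  define C where "C n \<omega> = (MAX j\<in>{1..p n}. C_max l h X Y \<beta> n j \<omega>)" for n \<omega>
  define Q where "Q = Q_pop M l h X Y \<beta>"
  define q where "q n j \<omega> = Q_hat l h X Y \<beta> n j \<omega>" for n j \<omega>
  define Z where "Z n j \<omega> = Z_hat l h X Y \<beta> n j \<omega>" for n j \<omega>
  \<comment> \<open>The expansion gives \<open>\<bar>\<beta>hat - \<beta>\<bar> = (1 / r) * (Q / q)
    * \<bar>Z / Q\<bar>\<close> with \<open>1 / r \<le> C n \<omega>\<close>, so
    \<open>C n \<omega>\<close> times the largest \<open>Q / q\<close> serves as the factor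
    \<open>1 + R\<close>. Truncation at 0 leaves only an upper estimate of \<open>R\<close> to
    prove. Off the event \<open>C n \<omega> \<le> 4/3\<close> no inequality is claimed, and the
    value 0 is harmless there.\<close>
  define R where "R n \<omega> = (if C n \<omega> \<le> ereal (4 / 3)
    then max 0 (real_of_ereal (C n \<omega>) * (MAX j\<in>{1..p n}. Q n j / q n j \<omega>) - 1) else 0)" for n \<omega>
  have ne: "{1..p n} \<noteq> {}" if "n \<ge> 1" for n
    using dim[OF that] by simp
  have C_max_le: "C_max l h X Y \<beta> n j \<omega> \<le> C n \<omega>" if "j \<in> {1..p n}" for n j \<omega>
    unfolding C_def using that by (intro Max_ge) auto
  have expansion: "\<exists>c r. C_max l h X Y \<beta> n j \<omega> = ereal c \<and> 1 \<le> c \<and> 1 / c \<le> r \<and> r \<le> c \<and>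
      q n j \<omega> > 0 \<and> \<beta>hat n j \<omega> - \<beta> n j = - Z n j \<omega> / (r * q n j \<omega>)"
    if "n \<ge> 1" "j \<in> {1..p n}" "\<omega> \<in> space (M n)" "C n \<omega> \<le> ereal (4 / 3)" for n j \<omega>
    using betahat_expansion[OF that(1) l_diff l_convex h_nonneg \<beta>hat_argmin[OF that(1-3)]
        Q_hat_nz[OF that(1-3)] order_trans[OF C_max_le[OF that(2)] that(4)]]
    unfolding q_def Z_def by metis
  have Q_pos: "Q n j > 0" if "n \<ge> 1" "j \<in> {1..p n}" for n j
  proof -
    have "Q n j \<ge> 0"
      unfolding Q_def Q_pop_def
      by (intro mult_nonneg_nonneg sum_nonneg Bochner_Integration.integral_nonneg
          loss''_nonneg[OF l_diff l_convex] h_nonneg) auto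
    then show ?thesis
      using Q_pop_nz[OF that] by (simp add: Q_def)
  qed
  have first: "ereal \<bar>\<beta>hat n j \<omega> - \<beta> n j + inverse (Q n j) * Z n j \<omega>\<bar>
      \<le> (C_max l h X Y \<beta> n j \<omega> - 1 + ereal \<bar>q n j \<omega> / Q n j - 1\<bar>) * ereal (delta l h X Y \<beta> n j \<omega>)"
    if hyps: "n \<ge> 1" "j \<in> {1..p n}" "\<omega> \<in> space (M n)" "C n \<omega> \<le> ereal (4 / 3)" for n j \<omega>
  proof -
    obtain c r where cr: "C_max l h X Y \<beta> n j \<omega> = ereal c" "1 \<le> c" "1 / c \<le> r" "r \<le> c"
      "q n j \<omega> > 0" "\<beta>hat n j \<omega> - \<beta> n j = - Z n j \<omega> / (r * q n j \<omega>)"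
      using expansion[OF hyps] by blast
    show ?thesis
      using expansion_error_le[OF cr(2-6), of "Q n j"] Q_pos[OF hyps(1,2)]
      by (simp add: cr(1) delta_def q_def Z_def one_ereal_def)
  qed
  \<comment> \<open>Two maxima differ by at most a common bound on the coordinatewise differences,
    so each \<open>j\<close> is treated separately against the same right-hand side.\<close>
  have second: "\<bar>(MAX j\<in>{1..p n}. \<beta>hat n j \<omega>) - (MAX j\<in>{1..p n}. \<beta> n j)\<bar>
      \<le> (1 + R n \<omega>) * (MAX j\<in>{1..p n}. \<bar>Z n j \<omega> / Q n j\<bar>)"
    if n: "n \<ge> 1" and \<omega>: "\<omega> \<in> space (M n)" and C: "C n \<omega> \<le> ereal (4 / 3)" for n \<omega>
  proof (rule abs_Max_diff_le)
    fix j
    assume j: "j \<in> {1..p n}"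
    obtain c r where cr: "C_max l h X Y \<beta> n j \<omega> = ereal c" "1 \<le> c" "1 / c \<le> r" "r \<le> c"
      "q n j \<omega> > 0" "\<beta>hat n j \<omega> - \<beta> n j = - Z n j \<omega> / (r * q n j \<omega>)"
      using expansion[OF n j \<omega> C] by blast
    have "0 < 1 / c" using cr(2) by simp
    then have r: "r > 0" using cr(3) by linarith
    \<comment> \<open>On this event \<open>C n \<omega>\<close> is finite, so
      \<open>real_of_ereal\<close> preserves the order.\<close>
    have c_le: "c \<le> real_of_ereal (C n \<omega>)"
      using C_max_le[OF j, of \<omega>] C cr(1) by (cases "C n \<omega>") auto
    have "1 / r \<le> c"
      using cr(2,3) r by (simp add: field_simps)
    then have "1 / r \<le> real_of_ereal (C n \<omega>)"
      using c_le by simp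
    moreover have "Q n j / q n j \<omega> \<le> (MAX j\<in>{1..p n}. Q n j / q n j \<omega>)"
      using j by (intro Max_ge) auto
    ultimately have "1 / r * (Q n j / q n j \<omega>)
        \<le> real_of_ereal (C n \<omega>) * (MAX j\<in>{1..p n}. Q n j / q n j \<omega>)"
      using cr(2,5) c_le Q_pos[OF n j] by (intro mult_mono) auto
    then have R: "1 / r * (Q n j / q n j \<omega>) \<le> 1 + R n \<omega>"
      using C by (simp add: R_def)
    have "\<bar>\<beta>hat n j \<omega> - \<beta> n j\<bar> = 1 / r * (Q n j / q n j \<omega>) * \<bar>Z n j \<omega> / Q n j\<bar>"
      using r cr(5) Q_pos[OF n j] by (simp add: cr(6) abs_mult)
    also have "\<dots> \<le> (1 + R n \<omega>) * (MAX j\<in>{1..p n}. \<bar>Z n j \<omega> / Q n j\<bar>)"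
      using j by (intro mult_mono R Max_ge) (auto simp: R_def)
    finally show "\<bar>\<beta>hat n j \<omega> - \<beta> n j\<bar> \<le> (1 + R n \<omega>) * (MAX j\<in>{1..p n}. \<bar>Z n j \<omega> / Q n j\<bar>)" .
  qed (use ne[OF n] in auto)
  have R_op1: "op1 M (\<lambda>n \<omega>. ereal (R n \<omega>))"
    if Q_op1: "op1 M (\<lambda>n \<omega>. ereal (MAX j\<in>{1..p n}. \<bar>q n j \<omega> / Q n j - 1\<bar>))"
      and C_op1: "op1 M (\<lambda>n \<omega>. C n \<omega> - 1)"
    using Q_op1 C_op1
  proof (rule op1_dominated)
    fix \<epsilon> :: real
    assume "\<epsilon> > 0"
    \<comment> \<open>The cap 1/2 keeps \<open>1 - \<eta> \<ge> 1 / 2\<close>. Then \<open>(1 +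
      \<eta>) / (1 - \<eta>) - 1 = 2 * \<eta> / (1 - \<eta>) \<le> 4 * \<eta> \<le>
      \<epsilon>\<close>.\<close>
    define \<eta> where "\<eta> = min (\<epsilon> / 4) (1 / 2)"
    have \<eta>: "\<eta> > 0" "\<eta> \<le> 1 / 2" "4 * \<eta> \<le> \<epsilon>"
      using \<open>\<epsilon> > 0\<close> by (auto simp: \<eta>_def)
    have \<eta>_bound: "(1 + \<eta>) * (1 / (1 - \<eta>)) - 1 \<le> \<epsilon>"
    proof -
      have "(1 + \<eta>) * (1 / (1 - \<eta>)) - 1 = 2 * \<eta> / (1 - \<eta>)"
        using \<eta> by (simp add: field_simps)
      also have "\<dots> \<le> 2 * \<eta> / (1 / 2)"
        using \<eta> by (intro divide_left_mono) auto
      finally show ?thesis using \<eta> by simp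
    qed
    have "\<bar>ereal (R n \<omega>)\<bar> \<le> ereal \<epsilon>"
      if n: "n \<ge> 1" and \<omega>: "\<omega> \<in> space (M n)"
        and E: "\<bar>ereal (MAX j\<in>{1..p n}. \<bar>q n j \<omega> / Q n j - 1\<bar>)\<bar> \<le> ereal \<eta>"
        and C1: "\<bar>C n \<omega> - 1\<bar> \<le> ereal \<eta>" for n \<omega>
    proof (cases "C n \<omega> \<le> ereal (4 / 3)")
      case True
      obtain c where c: "C n \<omega> = ereal c" "\<bar>c - 1\<bar> \<le> \<eta>"
        using C1 by (cases "C n \<omega>") (auto simp: one_ereal_def)
      have ratio_le: "0 < Q n j / q n j \<omega> \<and> Q n j / q n j \<omega> \<le> 1 / (1 - \<eta>)"
        if j: "j \<in> {1..p n}" for j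
      proof -
        have "\<bar>q n j \<omega> / Q n j - 1\<bar> \<le> (MAX j\<in>{1..p n}. \<bar>q n j \<omega> / Q n j - 1\<bar>)"
          using j by (intro Max_ge) auto
        also have "\<dots> \<le> \<eta>"
          using E by simp
        finally have "1 - \<eta> \<le> q n j \<omega> / Q n j"
          by linarith
        moreover have "q n j \<omega> > 0"
          using expansion[OF n j \<omega> True] by blast
        ultimately show ?thesis
          using Q_pos[OF n j] \<eta> by (simp add: field_simps)
      qed
      \<comment> \<open>The maximum is attained, so it inherits both the positivity and the upper
        bound of the individual quotients.\<close>
      have "(MAX j\<in>{1..p n}. Q n j / q n j \<omega>) \<in> (\<lambda>j. Q n j / q n j \<omega>) ` {1..p n}"
        using ne[OF n] by (intro Max_in) auto
      then have "c * (MAX j\<in>{1..p n}. Q n j / q n j \<omega>) \<le> (1 + \<eta>) * (1 / (1 - \<eta>))"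
        using ratio_le c(2) \<eta> by (intro mult_mono) (auto intro: less_imp_le)
      then have "R n \<omega> \<le> \<epsilon>"
        using True \<eta>_bound \<open>\<epsilon> > 0\<close> by (simp add: R_def c(1))
      then show ?thesis
        by (simp add: R_def)
    qed (use \<open>\<epsilon> > 0\<close> in \<open>simp add: R_def\<close>)
    then show "\<exists>\<eta>>0. \<forall>n\<ge>1. \<forall>\<omega>\<in>space (M n).
        \<bar>ereal (MAX j\<in>{1..p n}. \<bar>q n j \<omega> / Q n j - 1\<bar>)\<bar> \<le> ereal \<eta> \<longrightarrow>
        \<bar>C n \<omega> - 1\<bar> \<le> ereal \<eta> \<longrightarrow> \<bar>ereal (R n \<omega>)\<bar> \<le> ereal \<epsilon>"
      using \<eta>(1) by blast
  qed
  show ?thesis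
    using first second R_op1 unfolding C_def Q_def q_def Z_def by blast
qed

end
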